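(* Let $S$ be a measure preserving $m$-transformation of a normalized measure space $(X,\mathcal{B},\mu)$ and let $f\in \mathcal{L}^1(X,\mathcal{B},\mu)$. Then there exists a function $f^*\in \mathcal{L}^1(X,\mathcal{B},\mu)$ such that $A_n(f)\to f^*$ $\mu$-a.e. as $n\to\infty$. Furthermore, $Uf^*=f^*$ $\mu$-a.e. and $\int_X f^*\,\mathrm{d}\mu=\int_X f\,\mathrm{d}\mu$.
   Context: $(X,\mathcal{B},\mu)$ is a normalized measure space, i.e. $\mu(X)=1$, and $m$ is a positive integer. An $m$-transformation $S:X\to X$ is a multivalued map assigning to each $x\in X$ a subset $S(x)\subset X$ with $1\le |S(x)|\le m$, where $|A|$ is the number of elements of $A$. For $B\subset X$ and $k,l\in\mathbb{N}$ put $S^{-1}_{k;l}(B)=\{x\in X: |S(x)|=k,\ |S(x)\cap B|=l\}$. $S$ is measurable if $S^{-1}_{k;l}(B)\in\mathcal{B}$ for all $B\in\mathcal{B}$ and $k,l\in\mathbb{N}$. Put $K(x,B)=\frac{1}{|S(x)|}\sum_{y\in S(x)}\chi_B(y)$ and $S\mu(B)=\int_X K(x,B)\,\mathrm{d}\mu(x)$ for $B\in\mathcal{B}$. $S$ is measure preserving ($\mu$-preserving) if it is measurable and $S\mu=\mu$. For a function $f$ on $X$, $Uf(x)=\frac{1}{|S(x)|}\sum_{y\in S(x)}f(y)$, and $A_n(f)=\frac1n\sum_{k=0}^{n-1}U^kf$ for $n=1,2,\ldots$. *)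

theory Defs
  imports "HOL-Probability.Probability_Measure"
begin

text \<open>A multivalued map on the measure space \<open>M\<close> is a function \<open>S :: 'a \<Rightarrow> 'a set\<close>; only its
  values on \<^term>\<open>space M\<close> matter. Finiteness of \<open>S x\<close> is stated separately because \<^const>\<open>card\<close> of
  an infinite set is \<open>0\<close>.\<close>

definition m_transformation :: "nat \<Rightarrow> 'a measure \<Rightarrow> ('a \<Rightarrow> 'a set) \<Rightarrow> bool" where
  "m_transformation m M S \<longleftrightarrow>
     (\<forall>x\<in>space M. S x \<subseteq> space M \<and> finite (S x) \<and> 1 \<le> card (S x) \<and> card (S x) \<le> m)"

definition multi_preimage ::
  "'a measure \<Rightarrow> ('a \<Rightarrow> 'a set) \<Rightarrow> nat \<Rightarrow> nat \<Rightarrow> 'a set \<Rightarrow> 'a set" where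
  "multi_preimage M S k l B = {x \<in> space M. card (S x) = k \<and> card (S x \<inter> B) = l}"

definition multi_measurable :: "'a measure \<Rightarrow> ('a \<Rightarrow> 'a set) \<Rightarrow> bool" where
  "multi_measurable M S \<longleftrightarrow> (\<forall>B\<in>sets M. \<forall>k l. multi_preimage M S k l B \<in> sets M)"

definition multi_kernel :: "('a \<Rightarrow> 'a set) \<Rightarrow> 'a \<Rightarrow> 'a set \<Rightarrow> real" where
  "multi_kernel S x B = (1 / real (card (S x))) * (\<Sum>y\<in>S x. indicator B y)"

definition multi_image_measure :: "'a measure \<Rightarrow> ('a \<Rightarrow> 'a set) \<Rightarrow> 'a set \<Rightarrow> real" where
  "multi_image_measure M S B = (\<integral>x. multi_kernel S x B \<partial>M)"

definition multi_measure_preserving :: "'a measure \<Rightarrow> ('a \<Rightarrow> 'a set) \<Rightarrow> bool" where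
  "multi_measure_preserving M S \<longleftrightarrow>
     multi_measurable M S \<and> (\<forall>B\<in>sets M. multi_image_measure M S B = measure M B)"

definition multi_koopman :: "('a \<Rightarrow> 'a set) \<Rightarrow> ('a \<Rightarrow> real) \<Rightarrow> 'a \<Rightarrow> real" where
  "multi_koopman S f x = (1 / real (card (S x))) * (\<Sum>y\<in>S x. f y)"

definition ergodic_average :: "('a \<Rightarrow> 'a set) \<Rightarrow> nat \<Rightarrow> ('a \<Rightarrow> real) \<Rightarrow> 'a \<Rightarrow> real" where
  "ergodic_average S n f x = (1 / real n) * (\<Sum>k<n. (multi_koopman S ^^ k) f x)"

end

theory Submission
  imports Defs
begin

text \<open>The operator \<open>U\<close> is positive, fixes constants and preserves the integral, so Garsia's argument
  gives the maximal ergodic theorem. For \<open>f \<ge> 0\<close> let \<open>l\<close> be the lower limit of the averages. By Fatou's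
  lemma on the finite sets \<open>S x\<close> and on \<open>X\<close>, \<open>U l \<le> l\<close> and \<open>\<integral>l \<le> \<integral>f\<close>; the first is an equality almost
  everywhere because both sides have the same integral, and the maximal theorem for \<open>l + e - f\<close> turns
  the second into an equality. For bounded \<open>f\<close> the same applied to \<open>C - f\<close> gives convergence. The
  maximal inequality for \<open>f - min f k\<close> removes boundedness, and \<open>f = f\<^sup>+ - f\<^sup>-\<close> the sign.\<close>

section \<open>Pointwise algebra of the averaging operator and of its ergodic averages\<close>

lemma multi_koopman_add:
  "multi_koopman S (\<lambda>x. f x + g x) x = multi_koopman S f x + multi_koopman S g x"
  by (simp add: multi_koopman_def sum.distrib distrib_left)

lemma multi_koopman_diff:
  "multi_koopman S (\<lambda>x. f x - g x) x = multi_koopman S f x - multi_koopman S g x"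
  by (simp add: multi_koopman_def sum_subtractf right_diff_distrib)

lemma multi_koopman_cmult:
  "multi_koopman S (\<lambda>x. c * f x) x = c * multi_koopman S f x"
  by (simp add: multi_koopman_def mult_ac flip: sum_distrib_left)

lemma multi_koopman_sum:
  "multi_koopman S (\<lambda>x. \<Sum>k\<in>A. f k x) x = (\<Sum>k\<in>A. multi_koopman S (f k) x)"
  unfolding multi_koopman_def sum_distrib_left by (rule sum.swap)

lemma multi_koopman_mono:
  "(\<And>y. y \<in> S x \<Longrightarrow> f y \<le> g y) \<Longrightarrow> multi_koopman S f x \<le> multi_koopman S g x"
  unfolding multi_koopman_def by (intro mult_left_mono sum_mono) auto

lemma multi_koopman_cong:
  "(\<And>y. y \<in> S x \<Longrightarrow> f y = g y) \<Longrightarrow> multi_koopman S f x = multi_koopman S g x"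
  by (simp add: multi_koopman_def cong: sum.cong)

lemma multi_koopman_iterate_add:
  "(multi_koopman S ^^ k) (\<lambda>x. f x + g x) = (\<lambda>x. (multi_koopman S ^^ k) f x + (multi_koopman S ^^ k) g x)"
  by (induction k) (simp_all add: multi_koopman_add)

lemma multi_koopman_iterate_diff:
  "(multi_koopman S ^^ k) (\<lambda>x. f x - g x) = (\<lambda>x. (multi_koopman S ^^ k) f x - (multi_koopman S ^^ k) g x)"
  by (induction k) (simp_all add: multi_koopman_diff)

lemma ergodic_average_add:
  "ergodic_average S n (\<lambda>x. f x + g x) x = ergodic_average S n f x + ergodic_average S n g x"
  by (simp add: ergodic_average_def multi_koopman_iterate_add sum.distrib distrib_left)

lemma ergodic_average_diff:
  "ergodic_average S n (\<lambda>x. f x - g x) x = ergodic_average S n f x - ergodic_average S n g x"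
  by (simp add: ergodic_average_def multi_koopman_iterate_diff sum_subtractf right_diff_distrib)

lemma sum_iterate_eq_ergodic_average:
  "(\<Sum>k<n. (multi_koopman S ^^ k) f x) = real n * ergodic_average S n f x"
  by (cases "n = 0") (simp_all add: ergodic_average_def)

lemma sum_iterate_Suc:
  "(\<Sum>k<Suc n. (multi_koopman S ^^ k) f x)
     = f x + multi_koopman S (\<lambda>y. \<Sum>k<n. (multi_koopman S ^^ k) f y) x"
  by (simp add: sum.lessThan_Suc_shift multi_koopman_sum del: sum.lessThan_Suc)

text \<open>Applying the operator to the sum of the first \<open>n\<close> iterates gives the sum of
  the first \<open>n + 1\<close> without its initial term \<open>f\<close>. So an average is
  invariant up to the factor \<open>1 + 1/n\<close> and the vanishing term
  \<open>f x / n\<close>.\<close>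

lemma multi_koopman_ergodic_average:
  assumes "n > 0"
  shows "multi_koopman S (ergodic_average S n f) x
    = (1 + 1 / real n) * ergodic_average S (Suc n) f x - f x / real n"
proof -
  have "real n * multi_koopman S (ergodic_average S n f) x
      = multi_koopman S (\<lambda>y. \<Sum>k<n. (multi_koopman S ^^ k) f y) x"
    by (simp add: sum_iterate_eq_ergodic_average multi_koopman_cmult)
  also have "\<dots> = real (Suc n) * ergodic_average S (Suc n) f x - f x"
    using sum_iterate_Suc[of S f x n] by (simp only: sum_iterate_eq_ergodic_average)
  finally have "multi_koopman S (ergodic_average S n f) x
      = (real (Suc n) * ergodic_average S (Suc n) f x - f x) / real n"
    using assms by (simp add: eq_divide_eq mult.commute)
  then show ?thesis using assms by (simp add: diff_divide_distrib add_divide_distrib distrib_right)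
qed

text \<open>The extended nonnegative counterpart of \<open>multi_koopman\<close>. It permits
  induction on nonnegative measurable functions, monotone suprema and infinite lower limits without
  integrability conditions.\<close>

definition nn_koopman :: "('a \<Rightarrow> 'a set) \<Rightarrow> ('a \<Rightarrow> ennreal) \<Rightarrow> 'a \<Rightarrow> ennreal" where
  "nn_koopman S f x = ennreal (1 / real (card (S x))) * (\<Sum>y\<in>S x. f y)"

lemma ennreal_multi_koopman:
  "(\<And>y. y \<in> S x \<Longrightarrow> 0 \<le> f y) \<Longrightarrow> ennreal (multi_koopman S f x) = nn_koopman S (\<lambda>y. ennreal (f y)) x"
  unfolding multi_koopman_def nn_koopman_def
  by (subst ennreal_mult) (simp_all add: sum_nonneg sum_ennreal)

locale preserving_multi_map = prob_space M for M :: "'a measure" +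
  fixes S :: "'a \<Rightarrow> 'a set" and m :: nat
  assumes transformation: "m_transformation m M S"
    and preserving: "multi_measure_preserving M S"
begin

abbreviation U :: "('a \<Rightarrow> real) \<Rightarrow> 'a \<Rightarrow> real" where "U \<equiv> multi_koopman S"
abbreviation A :: "nat \<Rightarrow> ('a \<Rightarrow> real) \<Rightarrow> 'a \<Rightarrow> real" where "A \<equiv> ergodic_average S"

section \<open>Positivity and constants on the space\<close>

lemma
  assumes "x \<in> space M"
  shows values_in_space: "y \<in> S x \<Longrightarrow> y \<in> space M"
    and finite_values: "finite (S x)"
    and card_values_pos: "0 < card (S x)"
  using transformation assms by (auto simp: m_transformation_def Suc_le_eq)

lemma U_const: "x \<in> space M \<Longrightarrow> U (\<lambda>_. c) x = c"
  using card_values_pos[of x] by (simp add: multi_koopman_def)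

lemma iterate_const: "x \<in> space M \<Longrightarrow> (U ^^ k) (\<lambda>_. c) x = c"
proof (induction k arbitrary: x)
  case (Suc k)
  then have "U ((U ^^ k) (\<lambda>_. c)) x = U (\<lambda>_. c) x"
    by (intro multi_koopman_cong) (auto dest: values_in_space)
  with Suc show ?case by (simp add: U_const)
qed simp

lemma A_const: "x \<in> space M \<Longrightarrow> 0 < n \<Longrightarrow> A n (\<lambda>_. c) x = c"
  by (simp add: ergodic_average_def iterate_const)

lemma iterate_mono:
  assumes "\<And>y. y \<in> space M \<Longrightarrow> f y \<le> g y" "x \<in> space M"
  shows "(U ^^ k) f x \<le> (U ^^ k) g x"
  using assms(2)
proof (induction k arbitrary: x)
  case (Suc k)
  then show ?case by (auto intro!: multi_koopman_mono dest: values_in_space)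
qed (use assms in simp)

lemma A_mono:
  assumes "\<And>y. y \<in> space M \<Longrightarrow> f y \<le> g y" "x \<in> space M"
  shows "A n f x \<le> A n g x"
  unfolding ergodic_average_def
  by (intro mult_left_mono sum_mono iterate_mono) (use assms in auto)

lemma A_nonneg:
  assumes "\<And>y. y \<in> space M \<Longrightarrow> 0 \<le> f y" "x \<in> space M"
  shows "0 \<le> A n f x"
proof (cases "n = 0")
  case False
  then show ?thesis using A_mono[of "\<lambda>_. 0" f x n] assms A_const[of x n 0] by simp
qed (simp add: ergodic_average_def)

section \<open>Measurability and preservation of the integral\<close>

text \<open>Induction on nonnegative measurable functions; preservation of the measure enters in the
  indicator case. Both claims are proved together because additivity and monotone convergence of the
  integral need the measurability from the induction hypotheses.\<close>

lemma measurable_nn_koopman_and_nn_integral: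
  assumes "f \<in> borel_measurable M"
  shows "nn_koopman S f \<in> borel_measurable M \<and> (\<integral>\<^sup>+x. nn_koopman S f x \<partial>M) = (\<integral>\<^sup>+x. f x \<partial>M)"
  using assms
proof (induction rule: borel_measurable_induct)
  case (cong f g)
  have "nn_koopman S f x = nn_koopman S g x" if "x \<in> space M" for x
    using cong(3) values_in_space[OF that] by (simp add: nn_koopman_def cong: sum.cong)
  then show ?case using cong(3,4)
    by (metis (no_types, lifting) measurable_cong nn_integral_cong)
next
  case (set B)
  \<comment> \<open>Measurability of \<open>S\<close> speaks of the level sets of this pair. Its
    values form a countable set, so the pair is measurable, and with it the kernel, which is a
    function of the pair.\<close>
  define card_pair where "card_pair x = (card (S x), card (S x \<inter> B))" for x
  have "card_pair \<in> measurable M (count_space UNIV)"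
    unfolding measurable_count_space_eq2_countable
  proof safe
    fix k l
    have "card_pair -` {(k, l)} \<inter> space M = multi_preimage M S k l B"
      by (auto simp: card_pair_def multi_preimage_def)
    also have "\<dots> \<in> sets M"
      using preserving set by (simp add: multi_measure_preserving_def multi_measurable_def)
    finally show "card_pair -` {(k, l)} \<inter> space M \<in> sets M" .
  qed auto
  then have "(\<lambda>x. case card_pair x of (k, l) \<Rightarrow> 1 / real k * real l) \<in> borel_measurable M"
    by (rule measurable_compose) simp
  also have "?this \<longleftrightarrow> (\<lambda>x. multi_kernel S x B) \<in> borel_measurable M"
    by (intro measurable_cong)
      (simp add: card_pair_def multi_kernel_def finite_values indicator_def of_bool_def sum.If_cases Int_def)
  finally have [measurable]: "(\<lambda>x. multi_kernel S x B) \<in> borel_measurable M" .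
  \<comment> \<open>\<open>multi_image_measure\<close> is a Bochner integral, which is 0 by default
    for nonintegrable functions. The bounds 0 and 1 give integrability and so the passage to the
    extended integral.\<close>
  have nonneg: "0 \<le> multi_kernel S x B" for x
    by (simp add: multi_kernel_def sum_nonneg)
  have le_1: "multi_kernel S x B \<le> 1" if "x \<in> space M" for x
  proof -
    have "(\<Sum>y\<in>S x. indicator B y) \<le> (\<Sum>y\<in>S x. 1 :: real)" by (intro sum_mono) (simp add: indicator_def)
    then show ?thesis using card_values_pos[OF that] by (simp add: multi_kernel_def field_simps)
  qed
  have eq: "nn_koopman S (indicator B) x = ennreal (multi_kernel S x B)" for x
    unfolding multi_kernel_def nn_koopman_def
    by (subst ennreal_mult) (auto simp: sum_nonneg ennreal_indicator simp flip: sum_ennreal)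
  have "integrable M (\<lambda>x. multi_kernel S x B)"
    by (rule integrable_const_bound[where B=1]) (use nonneg le_1 in auto)
  then have "(\<integral>\<^sup>+x. ennreal (multi_kernel S x B) \<partial>M) = ennreal (multi_image_measure M S B)"
    unfolding multi_image_measure_def by (intro nn_integral_eq_integral) (use nonneg in auto)
  also have "\<dots> = emeasure M B"
    using preserving set by (simp add: multi_measure_preserving_def emeasure_eq_measure)
  finally show ?case
    using set by (simp add: eq[abs_def])
next
  case (mult u c)
  have "nn_koopman S (\<lambda>x. c * u x) = (\<lambda>x. c * nn_koopman S u x)"
    by (simp add: fun_eq_iff nn_koopman_def mult_ac flip: sum_distrib_left)
  with mult show ?case by (auto simp: nn_integral_cmult intro!: borel_measurable_times)
next
  case (add u v)
  have "nn_koopman S (\<lambda>x. v x + u x) = (\<lambda>x. nn_koopman S v x + nn_koopman S u x)"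
    by (simp add: fun_eq_iff nn_koopman_def sum.distrib distrib_left)
  with add show ?case by (auto simp: nn_integral_add intro!: borel_measurable_add)
next
  case (seq u)
  have mono: "incseq (\<lambda>i. u i y)" for y
    using \<open>incseq u\<close> by (simp add: incseq_def le_fun_def)
  have eq: "nn_koopman S (SUP i. u i) = (SUP i. nn_koopman S (u i))"
    using mono
    by (simp add: fun_eq_iff nn_koopman_def image_comp SUP_mult_left_ennreal flip: ennreal_SUP_sum)
  have "incseq (\<lambda>i. nn_koopman S (u i))"
    using mono by (auto simp: incseq_def le_fun_def nn_koopman_def intro!: mult_left_mono sum_mono)
  then have "(\<integral>\<^sup>+x. nn_koopman S (SUP i. u i) x \<partial>M) = (SUP i. \<integral>\<^sup>+x. nn_koopman S (u i) x \<partial>M)"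
    using seq by (simp add: eq image_comp nn_integral_monotone_convergence_SUP)
  also have "\<dots> = (SUP i. \<integral>\<^sup>+x. u i x \<partial>M)" using seq by simp
  also have "\<dots> = (\<integral>\<^sup>+x. (SUP i. u i) x \<partial>M)"
    using seq by (simp add: image_comp nn_integral_monotone_convergence_SUP)
  finally have "(\<integral>\<^sup>+x. nn_koopman S (SUP i. u i) x \<partial>M) = (\<integral>\<^sup>+x. (SUP i. u i) x \<partial>M)" .
  moreover have "(SUP i. nn_koopman S (u i)) = (\<lambda>x. SUP i. nn_koopman S (u i) x)"
    by (simp add: fun_eq_iff image_comp)
  then have "nn_koopman S (SUP i. u i) \<in> borel_measurable M"
    using seq by (simp only: eq) (intro borel_measurable_SUP; simp)
  ultimately show ?case by blast
qed

lemmas measurable_nn_koopman = measurable_nn_koopman_and_nn_integral[THEN conjunct1]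
lemmas nn_integral_nn_koopman = measurable_nn_koopman_and_nn_integral[THEN conjunct2]

text \<open>Positive and negative parts reduce this to \<open>nn_koopman\<close>, whose values on
  them are finite, so that \<open>enn2real\<close> loses nothing.\<close>

lemma measurable_U [measurable]:
  assumes [measurable]: "f \<in> borel_measurable M"
  shows "U f \<in> borel_measurable M"
proof -
  have "U f x = enn2real (nn_koopman S (\<lambda>x. ennreal (max 0 (f x))) x)
      - enn2real (nn_koopman S (\<lambda>x. ennreal (max 0 (- f x))) x)" for x
  proof -
    have "U f x = U (\<lambda>x. max 0 (f x) - max 0 (- f x)) x"
      by (intro multi_koopman_cong) auto
    also have "\<dots> = U (\<lambda>x. max 0 (f x)) x - U (\<lambda>x. max 0 (- f x)) x"
      by (rule multi_koopman_diff)
    finally have "U f x = U (\<lambda>x. max 0 (f x)) x - U (\<lambda>x. max 0 (- f x)) x" .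
    moreover have "enn2real (nn_koopman S (\<lambda>x. ennreal (max 0 (g x))) x) = U (\<lambda>x. max 0 (g x)) x" for g
      by (subst ennreal_multi_koopman[symmetric])
        (simp_all add: multi_koopman_def sum_nonneg)
    ultimately show ?thesis by simp
  qed
  moreover have [measurable]: "nn_koopman S (\<lambda>x. ennreal (max 0 (f x))) \<in> borel_measurable M"
    "nn_koopman S (\<lambda>x. ennreal (max 0 (- f x))) \<in> borel_measurable M"
    by (intro measurable_nn_koopman; measurable)+
  ultimately show ?thesis by (subst measurable_cong) auto
qed

lemma integrable_U_and_integral:
  assumes "integrable M f"
  shows "integrable M (U f) \<and> (\<integral>x. U f x \<partial>M) = (\<integral>x. f x \<partial>M)"
proof -
  have nonneg: "integrable M (U f) \<and> (\<integral>x. U f x \<partial>M) = (\<integral>x. f x \<partial>M)"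
    if f: "integrable M f" "\<And>x. 0 \<le> f x" for f
  proof -
    have [measurable]: "f \<in> borel_measurable M" using f by auto
    have Uf: "0 \<le> U f x" for x
      using f(2) by (simp add: multi_koopman_def sum_nonneg)
    have "(\<integral>\<^sup>+x. ennreal (U f x) \<partial>M) = (\<integral>\<^sup>+x. ennreal (f x) \<partial>M)"
      using f(2) by (simp add: ennreal_multi_koopman nn_integral_nn_koopman)
    moreover have "(\<integral>\<^sup>+x. ennreal (f x) \<partial>M) = ennreal (\<integral>x. f x \<partial>M)"
      using f by (intro nn_integral_eq_integral) auto
    moreover have "0 \<le> (\<integral>x. f x \<partial>M)" using f by simp
    ultimately have nn: "(\<integral>\<^sup>+x. ennreal (U f x) \<partial>M) = ennreal (\<integral>x. f x \<partial>M)" and "0 \<le> (\<integral>x. f x \<partial>M)"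
      by simp_all
    then show ?thesis
      using Uf by (simp add: integrableI_nn_integral_finite[OF _ _ nn] integral_eq_nn_integral[of "U f"])
  qed
  have eq: "U f = (\<lambda>x. U (\<lambda>y. max 0 (f y)) x - U (\<lambda>y. max 0 (- f y)) x)"
    unfolding multi_koopman_diff[symmetric] by (intro ext multi_koopman_cong) auto
  have "(\<integral>x. f x \<partial>M) = (\<integral>x. max 0 (f x) - max 0 (- f x) \<partial>M)"
    by (intro Bochner_Integration.integral_cong) auto
  then show ?thesis
    unfolding eq using nonneg[of "\<lambda>y. max 0 (f y)"] nonneg[of "\<lambda>y. max 0 (- f y)"] assms
    by (simp add: Bochner_Integration.integral_diff)
qed

lemmas integrable_U = integrable_U_and_integral[THEN conjunct1]
lemmas integral_U = integrable_U_and_integral[THEN conjunct2]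

lemma measurable_iterate [measurable]:
  "f \<in> borel_measurable M \<Longrightarrow> (U ^^ k) f \<in> borel_measurable M"
  by (induction k) (simp_all add: measurable_U)

lemma measurable_A [measurable]:
  "f \<in> borel_measurable M \<Longrightarrow> A n f \<in> borel_measurable M"
  unfolding ergodic_average_def[abs_def] by measurable

lemma integrable_iterate_and_integral:
  "integrable M f \<Longrightarrow> integrable M ((U ^^ k) f) \<and> (\<integral>x. (U ^^ k) f x \<partial>M) = (\<integral>x. f x \<partial>M)"
  by (induction k) (simp_all add: integrable_U integral_U)

lemma integrable_A: "integrable M f \<Longrightarrow> integrable M (A n f)"
  unfolding ergodic_average_def[abs_def] by (simp add: integrable_iterate_and_integral)

lemma integral_A: "integrable M f \<Longrightarrow> 0 < n \<Longrightarrow> (\<integral>x. A n f x \<partial>M) = (\<integral>x. f x \<partial>M)"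
  unfolding ergodic_average_def[abs_def] by (simp add: integrable_iterate_and_integral)

section \<open>Null sets and invariant functions\<close>

text \<open>The exceptional points lie in a null set \<open>N\<close>. By preservation
  \<open>nn_koopman S (indicator N)\<close> has integral 0, hence vanishes almost everywhere, so
  almost no \<open>x\<close> has a value in \<open>N\<close>. This allows identities known only
  almost everywhere to be used at the points of \<open>S x\<close>.\<close>

lemma AE_values:
  assumes "AE x in M. P x"
  shows "AE x in M. \<forall>y\<in>S x. P y"
proof -
  from assms obtain N where N: "{x \<in> space M. \<not> P x} \<subseteq> N" "N \<in> sets M" "emeasure M N = 0"
    by (auto elim!: AE_E)
  then have "(\<integral>\<^sup>+x. nn_koopman S (indicator N) x \<partial>M) = 0"
    by (simp add: nn_integral_nn_koopman)
  then have "AE x in M. nn_koopman S (indicator N) x = 0"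
    using N by (subst (asm) nn_integral_0_iff_AE) (auto intro!: measurable_nn_koopman)
  then show ?thesis
  proof (rule AE_mp, intro AE_I2 impI ballI)
    fix x y assume x: "x \<in> space M" "nn_koopman S (indicator N) x = 0" and y: "y \<in> S x"
    then have "y \<notin> N"
      using card_values_pos[OF x(1)] finite_values[OF x(1)]
      by (auto simp: nn_koopman_def indicator_def of_bool_def)
    with N(1) values_in_space[OF x(1) y] show "P y" by auto
  qed
qed

lemma AE_iterate_invariant:
  assumes "AE x in M. U l x = l x"
  shows "AE x in M. (U ^^ k) l x = l x"
proof (induction k)
  case (Suc k)
  from assms AE_values[OF Suc] show ?case
  proof eventually_elim
    case (elim x)
    then have "U ((U ^^ k) l) x = U l x" by (intro multi_koopman_cong) auto
    with elim show ?case by simp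
  qed
qed simp

lemma AE_A_invariant:
  assumes "AE x in M. U l x = l x"
  shows "AE x in M. \<forall>n>0. A n l x = l x"
proof -
  have "AE x in M. \<forall>k. (U ^^ k) l x = l x"
    using AE_iterate_invariant[OF assms] by (simp add: AE_all_countable)
  then show ?thesis by eventually_elim (simp add: ergodic_average_def)
qed

section \<open>The maximal ergodic theorem\<close>

text \<open>For a single-valued map this is the maximum of 0 and the first \<open>n\<close> partial
  sums. Here \<open>U\<close> averages over several points and need not commute with the maximum.
  The recursion still majorizes the partial sums, and where \<open>garsia g (Suc n)\<close> is
  positive it equals \<open>g + U (garsia g n)\<close>.\<close>

fun garsia :: "('a \<Rightarrow> real) \<Rightarrow> nat \<Rightarrow> 'a \<Rightarrow> real" where
  "garsia g 0 = (\<lambda>x. 0)"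
| "garsia g (Suc n) = (\<lambda>x. max 0 (g x + U (garsia g n) x))"

lemma garsia_nonneg: "0 \<le> garsia g n x"
  by (cases n) auto

lemma garsia_mono_Suc: "garsia g n x \<le> garsia g (Suc n) x"
proof (induction n arbitrary: x)
  case (Suc n)
  have "U (garsia g n) x \<le> U (garsia g (Suc n)) x" by (intro multi_koopman_mono Suc)
  then show ?case by (auto simp: max_def)
qed simp

lemma incseq_garsia: "incseq (\<lambda>n. garsia g n x)"
  by (rule incseq_SucI) (rule garsia_mono_Suc)

lemma integrable_garsia: "integrable M g \<Longrightarrow> integrable M (garsia g n)"
  by (induction n) (simp_all add: integrable_U)

lemma sum_iterate_le_garsia: "(\<Sum>k<n. (U ^^ k) g x) \<le> garsia g n x"
proof (induction n arbitrary: x)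
  case (Suc n)
  have "(\<Sum>k<Suc n. (U ^^ k) g x) = g x + U (\<lambda>y. \<Sum>k<n. (U ^^ k) g y) x"
    by (rule sum_iterate_Suc)
  also have "\<dots> \<le> g x + U (garsia g n) x" by (intro add_left_mono multi_koopman_mono Suc)
  also have "\<dots> \<le> garsia g (Suc n) x" by simp
  finally show ?case .
qed simp

text \<open>Where \<open>garsia g n\<close> is positive, it is at most \<open>g + U (garsia g n)\<close>; integrating, the two
  \<open>garsia\<close> terms cancel because \<open>U\<close> preserves the integral.\<close>

lemma integral_garsia_pos:
  assumes g: "integrable M g"
  shows "0 \<le> (\<integral>x. indicator {x \<in> space M. 0 < garsia g n x} x * g x \<partial>M)"
proof -
  let ?P = "garsia g n"
  have P: "integrable M ?P" using g by (rule integrable_garsia)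
  have [measurable]: "?P \<in> borel_measurable M" "g \<in> borel_measurable M" using P g by auto
  have "0 = (\<integral>x. ?P x - U ?P x \<partial>M)"
    using P by (simp add: integrable_U integral_U)
  also have "\<dots> \<le> (\<integral>x. indicator {x \<in> space M. 0 < ?P x} x * g x \<partial>M)"
  proof (rule integral_mono)
    show "integrable M (\<lambda>x. ?P x - U ?P x)" using P by (simp add: integrable_U)
    show "integrable M (\<lambda>x. indicator {x \<in> space M. 0 < ?P x} x * g x)"
      using integrable_mult_indicator[OF _ g, of "{x \<in> space M. 0 < ?P x}"] by simp
    fix x assume x: "x \<in> space M"
    show "?P x - U ?P x \<le> indicator {x \<in> space M. 0 < ?P x} x * g x"
    proof (cases "0 < ?P x")
      case True
      then obtain k where n: "n = Suc k" by (cases n) auto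
      \<comment> \<open>The recursion yields \<open>U\<close> of the preceding function; raising its
        index to \<open>n\<close> only lowers the left side of the goal.\<close>
      have "U (garsia g k) x \<le> U ?P x"
        unfolding n by (intro multi_koopman_mono garsia_mono_Suc)
      moreover have "?P x = g x + U (garsia g k) x" using True by (simp add: n max_def split: if_splits)
      ultimately show ?thesis using True x by simp
    next
      case False
      \<comment> \<open>Here \<open>?P x\<close> is 0, and the subtracted \<open>U ?P x\<close> is
        nonnegative.\<close>
      have "U (\<lambda>_. 0) x \<le> U ?P x" by (intro multi_koopman_mono garsia_nonneg)
      with False garsia_nonneg[of g n x] x show ?thesis by (simp add: U_const)
    qed
  qed
  finally show ?thesis .
qed

text \<open>\<open>E\<close> is the increasing union of the positivity sets of
  \<open>garsia g n\<close>, and dominated convergence carries \<open>integral_garsia_pos\<close> to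
  it. \<open>E\<close> may exceed the set where some partial sum is positive; the later uses only
  need that it contains this set.\<close>

lemma maximal_ergodic:
  assumes g: "integrable M g"
  obtains E where "E \<in> sets M"
    "\<And>x n. x \<in> space M \<Longrightarrow> 0 < (\<Sum>k<n. (U ^^ k) g x) \<Longrightarrow> x \<in> E"
    "0 \<le> (\<integral>x. indicator E x * g x \<partial>M)"
proof
  let ?E = "\<lambda>n. {x \<in> space M. 0 < garsia g n x}"
  have [measurable]: "garsia g n \<in> borel_measurable M" for n using integrable_garsia[OF g] by auto
  have [measurable]: "g \<in> borel_measurable M" using g by auto
  show "(\<Union>n. ?E n) \<in> sets M" by measurable
  show "x \<in> (\<Union>n. ?E n)" if "x \<in> space M" "0 < (\<Sum>k<n. (U ^^ k) g x)" for x n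
  proof -
    have "0 < garsia g n x" using that(2) sum_iterate_le_garsia by (rule less_le_trans)
    with that(1) show ?thesis by blast
  qed
  have "incseq ?E"
    by (auto simp: incseq_def intro: less_le_trans incseqD[OF incseq_garsia])
  then have lim: "(\<lambda>n. indicator (?E n) x :: real) \<longlonglongrightarrow> indicator (\<Union>n. ?E n) x" for x
    by (rule LIMSEQ_indicator_incseq)
  have "(\<lambda>n. \<integral>x. indicator (?E n) x * g x \<partial>M) \<longlonglongrightarrow> (\<integral>x. indicator (\<Union>n. ?E n) x * g x \<partial>M)"
  proof (rule integral_dominated_convergence[where w = "\<lambda>x. \<bar>g x\<bar>"])
    show "AE x in M. (\<lambda>n. indicator (?E n) x * g x) \<longlonglongrightarrow> indicator (\<Union>n. ?E n) x * g x"
      by (intro AE_I2 tendsto_mult lim tendsto_const)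
  qed (use g in \<open>auto simp: indicator_def of_bool_def\<close>)
  then show "0 \<le> (\<integral>x. indicator (\<Union>n. ?E n) x * g x \<partial>M)"
    by (rule LIMSEQ_le_const) (use integral_garsia_pos[OF g] in auto)
qed

section \<open>The lower limit of the averages of a nonnegative function\<close>

text \<open>On the finite set \<open>S x\<close> the operator is integration against a scaled
  counting measure, so this is Fatou's lemma.\<close>

lemma nn_koopman_liminf:
  assumes "x \<in> space M"
  shows "nn_koopman S (\<lambda>y. liminf (\<lambda>n. h n y)) x \<le> liminf (\<lambda>n. nn_koopman S (h n) x)"
proof -
  define N where "N = scale_measure (ennreal (1 / real (card (S x)))) (count_space (S x))"
  have eq: "nn_koopman S g x = (\<integral>\<^sup>+y. g y \<partial>N)" for g
    using finite_values[OF assms]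
    by (simp add: N_def nn_koopman_def nn_integral_scale_measure nn_integral_count_space_finite)
  show ?thesis
    unfolding eq by (rule nn_integral_liminf) (simp add: N_def)
qed

text \<open>Fatou moves the operator inside the lower limit. There \<open>U (A n f)\<close> is at
  most \<open>1 + 1/n\<close> times the next average, because the term subtracted in
  \<open>multi_koopman_ergodic_average\<close> is nonnegative.\<close>

lemma nn_koopman_lower_average_le:
  assumes f: "\<And>x. 0 \<le> f x" and x: "x \<in> space M"
  shows "nn_koopman S (\<lambda>y. liminf (\<lambda>n. ennreal (A n f y))) x \<le> liminf (\<lambda>n. ennreal (A n f x))"
proof -
  have "nn_koopman S (\<lambda>y. liminf (\<lambda>n. ennreal (A n f y))) x
      \<le> liminf (\<lambda>n. nn_koopman S (\<lambda>y. ennreal (A n f y)) x)"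
    using x by (rule nn_koopman_liminf)
  also have "\<dots> = liminf (\<lambda>n. ennreal (U (A n f) x))"
    using f values_in_space[OF x] by (simp add: ennreal_multi_koopman A_nonneg)
  also have "\<dots> \<le> liminf (\<lambda>n. ennreal (A n f x))" (is "?l \<le> _")
    unfolding le_Liminf_iff
  proof (intro allI impI)
    fix y assume "y < ?l"
    \<comment> \<open>The factor \<open>1 + 1/n\<close> is absorbed by a number \<open>r\<close>
      strictly between \<open>y = s\<close> and the lower limit: eventually
      \<open>(1 + 1/n) * s < r\<close>.\<close>
    then obtain z where z: "y < z" "z < ?l" by (elim dense[THEN exE]) auto
    then obtain r where r: "z = ennreal r" "0 \<le> r" by (cases z) auto
    with z obtain s where s: "y = ennreal s" "0 \<le> s" "s < r"
      by (cases y) (auto simp: ennreal_less_iff)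
    have "(\<lambda>n. (1 + 1 / real n) * s) \<longlonglongrightarrow> (1 + 0) * s"
      by (intro tendsto_mult tendsto_add tendsto_const lim_1_over_n)
    then have "\<forall>\<^sub>F n in sequentially. (1 + 1 / real n) * s < r"
      by (rule order_tendstoD) (use s in simp)
    with less_LiminfD[OF z(2)] eventually_gt_at_top[of 0]
    have "\<forall>\<^sub>F n in sequentially. y < ennreal (A (Suc n) f x)"
    proof eventually_elim
      case (elim n)
      have "U (A n f) x \<le> (1 + 1 / real n) * A (Suc n) f x"
        using elim(2) f[of x] by (simp add: multi_koopman_ergodic_average)
      moreover have "r < U (A n f) x" using elim(1) r by (simp add: ennreal_less_iff)
      ultimately have "(1 + 1 / real n) * s < (1 + 1 / real n) * A (Suc n) f x"
        using elim(3) by linarith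
      moreover have "0 < 1 + 1 / real n" by (simp add: add_pos_nonneg)
      ultimately have "s < A (Suc n) f x" using mult_less_cancel_left_pos by blast
      then show ?case using s by (simp add: ennreal_less_iff)
    qed
    then show "\<forall>\<^sub>F n in sequentially. y < ennreal (A n f x)"
      by (rule eventually_sequentially_Suc[THEN iffD1])
  qed
  finally show ?thesis .
qed

text \<open>Supplies the future limit function before convergence is known: a finite version of the
  lower limit that already has the invariance and the integral demanded of the limit.\<close>

lemma lower_average:
  assumes f: "integrable M f" "\<And>x. 0 \<le> f x"
  obtains l where "integrable M l" "\<And>x. 0 \<le> l x"
    "AE x in M. liminf (\<lambda>n. ennreal (A n f x)) = ennreal (l x)"
    "AE x in M. U l x = l x" "(\<integral>x. l x \<partial>M) = (\<integral>x. f x \<partial>M)"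
proof -
  have [measurable]: "f \<in> borel_measurable M" using f by auto
  define L where "L x = liminf (\<lambda>n. ennreal (A n f x))" for x
  define l where "l x = enn2real (L x)" for x
  have [measurable]: "L \<in> borel_measurable M" unfolding L_def[abs_def] by measurable
  have [measurable]: "l \<in> borel_measurable M" unfolding l_def[abs_def] by measurable
  have l_nonneg: "0 \<le> l x" for x by (simp add: l_def)
  have "(\<integral>\<^sup>+x. L x \<partial>M) \<le> liminf (\<lambda>n. \<integral>\<^sup>+x. ennreal (A n f x) \<partial>M)"
    unfolding L_def by (rule nn_integral_liminf) measurable
  also have "\<dots> \<le> liminf (\<lambda>n. ennreal (\<integral>x. f x \<partial>M))"
  proof (rule Liminf_mono, rule eventually_mono[OF eventually_gt_at_top[of 0]])
    fix n :: nat assume "0 < n"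
    then show "(\<integral>\<^sup>+x. ennreal (A n f x) \<partial>M) \<le> ennreal (\<integral>x. f x \<partial>M)"
      using f by (subst nn_integral_eq_integral) (auto simp: integrable_A integral_A A_nonneg)
  qed
  also have "\<dots> = ennreal (\<integral>x. f x \<partial>M)" by (simp add: Liminf_const)
  finally have int_L: "(\<integral>\<^sup>+x. L x \<partial>M) \<le> ennreal (\<integral>x. f x \<partial>M)" .
  then have "(\<integral>\<^sup>+x. L x \<partial>M) \<noteq> \<infinity>" by (auto simp: top_unique)
  then have "AE x in M. L x \<noteq> \<infinity>" by (intro nn_integral_PInf_AE) auto
  then have L_eq: "AE x in M. L x = ennreal (l x)"
    by eventually_elim (simp add: l_def ennreal_enn2real_if)
  then have int_l: "(\<integral>\<^sup>+x. ennreal (l x) \<partial>M) = (\<integral>\<^sup>+x. L x \<partial>M)"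
    by (intro nn_integral_cong_AE) auto
  have l: "integrable M l"
    using l_nonneg int_l \<open>(\<integral>\<^sup>+x. L x \<partial>M) \<noteq> \<infinity>\<close>
    by (intro integrableI_bounded) (simp_all add: less_top[symmetric])
  have int_le: "(\<integral>x. l x \<partial>M) \<le> (\<integral>x. f x \<partial>M)"
  proof -
    have "0 \<le> (\<integral>x. f x \<partial>M)" using f(2) by (rule Bochner_Integration.integral_nonneg)
    moreover have "(\<integral>\<^sup>+x. ennreal (l x) \<partial>M) = ennreal (\<integral>x. l x \<partial>M)"
      using l l_nonneg by (intro nn_integral_eq_integral) auto
    ultimately show ?thesis using int_L int_l by (metis ennreal_le_iff)
  qed
  have le: "AE x in M. U l x \<le> l x"
    using L_eq
  proof (rule AE_mp, intro AE_I2 impI)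
    fix x assume x: "x \<in> space M" "L x = ennreal (l x)"
    have "ennreal (U l x) = nn_koopman S (\<lambda>y. ennreal (l y)) x"
      using l_nonneg by (intro ennreal_multi_koopman)
    \<comment> \<open>\<open>enn2real\<close> sends infinity to 0, so \<open>l\<close> is below
      \<open>L\<close> at every point, including all points of \<open>S x\<close>; no exceptional
      set has to be tracked here.\<close>
    also have "\<dots> \<le> nn_koopman S L x"
      unfolding nn_koopman_def l_def
      by (intro mult_left_mono sum_mono) (auto simp: ennreal_enn2real_if)
    also have "\<dots> \<le> L x"
      using nn_koopman_lower_average_le[of f x] f x by (simp add: L_def[abs_def])
    finally show "U l x \<le> l x" using x l_nonneg by (simp add: ennreal_le_iff)
  qed
  have "AE x in M. l x - U l x = 0"
    using l le by (subst integral_nonneg_eq_0_iff_AE[symmetric]) (auto simp: integrable_U integral_U)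
  then have inv: "AE x in M. U l x = l x" by eventually_elim simp
  have "(\<integral>x. f x \<partial>M) \<le> (\<integral>x. l x \<partial>M) + e" if e: "0 < e" for e
  proof -
    \<comment> \<open>By invariance of \<open>l\<close> the averages of \<open>?g\<close> are almost
      everywhere \<open>l + e - A n f\<close>. Since the lower limit \<open>l\<close> is strictly
      below \<open>l + e\<close>, one of them is positive, so \<open>E\<close> has full
      measure.\<close>
    let ?g = "\<lambda>x. l x + e - f x"
    have g: "integrable M ?g" using l f by simp
    obtain E where E: "E \<in> sets M"
      "\<And>x n. x \<in> space M \<Longrightarrow> 0 < (\<Sum>k<n. (U ^^ k) ?g x) \<Longrightarrow> x \<in> E"
      "0 \<le> (\<integral>x. indicator E x * ?g x \<partial>M)"
      using maximal_ergodic[OF g] by blast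
    have "AE x in M. x \<in> E"
      using L_eq AE_A_invariant[OF inv] AE_space
    proof eventually_elim
      case (elim x)
      have "\<exists>n>0. A n f x < l x + e"
      proof (rule ccontr)
        assume "\<not> ?thesis"
        then have "l x + e \<le> A n f x" if "0 < n" for n using that by (meson not_less)
        then have "\<forall>\<^sub>F n in sequentially. ennreal (l x + e) \<le> ennreal (A n f x)"
          by (intro eventually_mono[OF eventually_gt_at_top[of 0]] ennreal_leI)
        then have "ennreal (l x + e) \<le> L x" unfolding L_def by (rule Liminf_bounded)
        then show False using elim(1) e l_nonneg[of x] by (simp add: ennreal_le_iff)
      qed
      then obtain n where n: "n > 0" "A n f x < l x + e" by blast
      then have "0 < real n * A n ?g x"
        using elim by (simp add: ergodic_average_diff ergodic_average_add A_const)
      then show "x \<in> E" using E(2)[OF elim(3)] by (simp add: sum_iterate_eq_ergodic_average)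
    qed
    then have "(\<integral>x. indicator E x * ?g x \<partial>M) = (\<integral>x. ?g x \<partial>M)"
      using E(1) by (intro integral_cong_AE) auto
    with E(3) l f show ?thesis by (simp add: prob_space)
  qed
  then have "(\<integral>x. f x \<partial>M) \<le> (\<integral>x. l x \<partial>M)" by (rule field_le_epsilon)
  with int_le have "(\<integral>x. l x \<partial>M) = (\<integral>x. f x \<partial>M)" by simp
  with that[OF l l_nonneg _ inv] L_eq show thesis unfolding L_def by blast
qed

section \<open>Convergence for bounded functions\<close>

lemma eventually_gt_of_liminf_ennreal:
  fixes a :: "nat \<Rightarrow> real"
  assumes "liminf (\<lambda>n. ennreal (a n)) = ennreal l" "\<And>n. 0 \<le> a n" "0 \<le> l" "0 < e"
  shows "\<forall>\<^sub>F n in sequentially. l - e < a n"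
proof (cases "l < e")
  \<comment> \<open>\<open>ennreal\<close> truncates negative numbers to 0, so a negative
    \<open>l - e\<close> is handled by the sign of \<open>a\<close> instead.\<close>
  case True
  then have "l - e < a n" for n using assms(2)[of n] by linarith
  then show ?thesis by simp
next
  case False
  then have "ennreal (l - e) < liminf (\<lambda>n. ennreal (a n))"
    using assms by (simp add: ennreal_less_iff)
  then have "\<forall>\<^sub>F n in sequentially. ennreal (l - e) < ennreal (a n)" by (rule less_LiminfD)
  then show ?thesis by eventually_elim (use False in \<open>simp add: ennreal_less_iff\<close>)
qed

text \<open>The lower limits of the averages of \<open>f\<close> and of \<open>C - f\<close> have integrals adding up to \<open>C\<close>, so
  the lower and the upper limit for \<open>f\<close> coincide almost everywhere.\<close>

lemma AE_convergent_A_bounded: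
  assumes [measurable]: "f \<in> borel_measurable M" and f: "\<And>x. 0 \<le> f x" "\<And>x. f x \<le> C"
  shows "AE x in M. convergent (\<lambda>n. A n f x)"
proof -
  have int_f: "integrable M f"
    by (rule integrable_const_bound[where B = C]) (use f in auto)
  have int_Cf: "integrable M (\<lambda>x. C - f x)" using int_f by simp
  have Cf: "0 \<le> C - f x" for x using f(2)[of x] by simp
  obtain l where l: "integrable M l" "\<And>x. 0 \<le> l x"
    "AE x in M. liminf (\<lambda>n. ennreal (A n f x)) = ennreal (l x)"
    "AE x in M. U l x = l x" "(\<integral>x. l x \<partial>M) = (\<integral>x. f x \<partial>M)"
    by (rule lower_average[OF int_f f(1)]) (rule that)
  obtain l' where l': "integrable M l'" "\<And>x. 0 \<le> l' x"
    "AE x in M. liminf (\<lambda>n. ennreal (A n (\<lambda>x. C - f x) x)) = ennreal (l' x)"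
    "AE x in M. U l' x = l' x" "(\<integral>x. l' x \<partial>M) = (\<integral>x. C - f x \<partial>M)"
    by (rule lower_average[OF int_Cf Cf]) (rule that)
  \<comment> \<open>For \<open>n > 0\<close> the average of \<open>C - f\<close> is
    \<open>C - A n f\<close>, so the lower limit \<open>l'\<close> becomes the upper bound
    \<open>C - l'\<close>.\<close>
  have bounds: "AE x in M. \<forall>e>0. \<forall>\<^sub>F n in sequentially. l x - e < A n f x \<and> A n f x < C - l' x + e"
    using l(3) l'(3) AE_space
  proof eventually_elim
    case (elim x)
    show ?case
    proof (intro allI impI)
      fix e :: real assume e: "0 < e"
      have "\<forall>\<^sub>F n in sequentially. l x - e < A n f x"
        by (rule eventually_gt_of_liminf_ennreal[OF elim(1) A_nonneg[OF f(1) elim(3)] l(2) e])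
      moreover have "\<forall>\<^sub>F n in sequentially. l' x - e < A n (\<lambda>x. C - f x) x"
        by (rule eventually_gt_of_liminf_ennreal[OF elim(2) A_nonneg[OF Cf elim(3)] l'(2) e])
      ultimately show "\<forall>\<^sub>F n in sequentially. l x - e < A n f x \<and> A n f x < C - l' x + e"
        using eventually_gt_at_top[of 0]
        by eventually_elim (use elim in \<open>simp add: ergodic_average_diff A_const\<close>)
    qed
  qed
  have "AE x in M. l x + l' x \<le> C"
    using bounds
  proof eventually_elim
    case (elim x)
    have "l x \<le> C - l' x + e" if "0 < e" for e
    proof -
      from elim[rule_format, of "e/2"] that have "\<forall>\<^sub>F n in sequentially. l x - e/2 < A n f x \<and> A n f x < C - l' x + e/2" by simp
      then obtain n where "l x - e/2 < A n f x \<and> A n f x < C - l' x + e/2"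
        using eventually_happens'[OF sequentially_bot] by blast
      then show ?thesis by simp
    qed
    then have "l x \<le> C - l' x" by (rule field_le_epsilon)
    then show ?case by simp
  qed
  then have "AE x in M. 0 \<le> C - l x - l' x" by eventually_elim simp
  moreover have "(\<integral>x. C - l x - l' x \<partial>M) = 0"
    using l(1,5) l'(1,5) int_f by (simp add: prob_space)
  ultimately have "AE x in M. C - l x - l' x = 0"
    using l(1) l'(1) by (subst integral_nonneg_eq_0_iff_AE[symmetric]) auto
  with bounds show ?thesis
  proof eventually_elim
    case (elim x)
    have "(\<lambda>n. A n f x) \<longlonglongrightarrow> l x"
      unfolding tendsto_iff dist_real_def
    proof (intro allI impI)
      fix e :: real assume "0 < e"
      with elim(1) have "\<forall>\<^sub>F n in sequentially. l x - e < A n f x \<and> A n f x < C - l' x + e" by simp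
      then show "\<forall>\<^sub>F n in sequentially. \<bar>A n f x - l x\<bar> < e"
        by eventually_elim (use elim(2) in auto)
    qed
    then show ?case by (rule convergentI)
  qed
qed

section \<open>Convergence for nonnegative integrable functions\<close>

text \<open>The maximal theorem for \<open>g - c\<close> bounds \<open>c * prob E\<close> by the
  integral of \<open>g\<close> over \<open>E\<close>, and nonnegativity of \<open>g\<close> extends
  that integral to the whole space.\<close>

lemma maximal_inequality:
  assumes g: "integrable M g" "\<And>x. 0 \<le> g x"
  obtains E where "E \<in> sets M" "\<And>x n. x \<in> space M \<Longrightarrow> 0 < n \<Longrightarrow> c < A n g x \<Longrightarrow> x \<in> E"
    "c * prob E \<le> (\<integral>x. g x \<partial>M)"
proof -
  have "integrable M (\<lambda>x. g x - c)" using g by simp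
  then obtain E where E: "E \<in> sets M"
    "\<And>x n. x \<in> space M \<Longrightarrow> 0 < (\<Sum>k<n. (U ^^ k) (\<lambda>x. g x - c) x) \<Longrightarrow> x \<in> E"
    "0 \<le> (\<integral>x. indicator E x * (g x - c) \<partial>M)"
    using maximal_ergodic by blast
  have Eg: "integrable M (\<lambda>x. indicator E x * g x)"
    using integrable_mult_indicator[OF E(1) g(1)] by simp
  have "(\<integral>x. indicator E x * (g x - c) \<partial>M) = (\<integral>x. indicator E x * g x - c * indicator E x \<partial>M)"
    by (simp add: algebra_simps)
  also have "\<dots> = (\<integral>x. indicator E x * g x \<partial>M) - c * prob E"
    using Eg E(1) by (subst Bochner_Integration.integral_diff) (auto simp: emeasure_eq_measure)
  finally have "c * prob E \<le> (\<integral>x. indicator E x * g x \<partial>M)" using E(3) by simp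
  also have "\<dots> \<le> (\<integral>x. g x \<partial>M)"
    using Eg g by (intro integral_mono) (auto simp: indicator_def of_bool_def)
  finally have "c * prob E \<le> (\<integral>x. g x \<partial>M)" .
  moreover have "x \<in> E" if "x \<in> space M" "0 < n" "c < A n g x" for x n
    using that E(2)[of x n]
    by (simp add: sum_iterate_eq_ergodic_average ergodic_average_diff A_const)
  ultimately show thesis using that E(1) by blast
qed

text \<open>The truncation \<open>f' k\<close> is bounded, so its averages converge. The remainder
  \<open>g k\<close> has small integral for large \<open>k\<close>, and the maximal inequality makes
  all its averages small at once outside a set of small measure.\<close>

lemma AE_convergent_A_nonneg:
  assumes f: "integrable M f" "\<And>x. 0 \<le> f x"
  shows "AE x in M. convergent (\<lambda>n. A n f x)"
proof -
  have [measurable]: "f \<in> borel_measurable M" using f by auto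
  define f' where "f' k x = min (f x) (real k)" for k :: nat and x
  define g where "g k x = f x - f' k x" for k x
  have [measurable]: "f' k \<in> borel_measurable M" for k unfolding f'_def[abs_def] by measurable
  have [measurable]: "g k \<in> borel_measurable M" for k unfolding g_def[abs_def] by measurable
  have g_nonneg: "0 \<le> g k x" for k x by (simp add: g_def f'_def)
  have g_le: "g k x \<le> f x" for k x using f(2)[of x] by (simp add: g_def f'_def)
  have int_g: "integrable M (g k)" for k
    by (rule Bochner_Integration.integrable_bound[OF f(1)]) (use g_nonneg g_le f(2) in auto)
  have "(\<lambda>k. \<integral>x. g k x \<partial>M) \<longlonglongrightarrow> (\<integral>x. 0 \<partial>M)"
  proof (rule integral_dominated_convergence[where w = f])
    show "AE x in M. (\<lambda>k. g k x) \<longlonglongrightarrow> 0"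
    proof (intro AE_I2 tendsto_eventually)
      fix x
      obtain K where "f x \<le> real K" using real_arch_simple by blast
      then show "\<forall>\<^sub>F k in sequentially. g k x = 0"
        by (intro eventually_mono[OF eventually_ge_at_top[of K]]) (simp add: g_def f'_def)
    qed
  qed (use f g_nonneg g_le in auto)
  then have g_lim: "(\<lambda>k. \<integral>x. g k x \<partial>M) \<longlonglongrightarrow> 0" by simp
  \<comment> \<open>The index \<open>k\<close> may depend on \<open>x\<close>: a point failing for
    every \<open>k\<close> lies in all \<open>E k\<close>, and for each \<open>k\<close> the measure
    of their intersection is at most the integral of \<open>g k\<close> divided by \<open>e\<close>,
    hence it is 0.\<close>
  have "AE x in M. \<exists>k. \<forall>n>0. A n (g k) x \<le> e" if e: "0 < e" for e
  proof -
    have "\<exists>E. E \<in> sets M \<and> (\<forall>x n. x \<in> space M \<longrightarrow> 0 < n \<longrightarrow> e < A n (g k) x \<longrightarrow> x \<in> E) \<and>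
        e * prob E \<le> (\<integral>x. g k x \<partial>M)" for k
      by (rule maximal_inequality[OF int_g[of k] g_nonneg, of e]) blast
    then obtain E where "\<forall>k. E k \<in> sets M \<and>
        (\<forall>x n. x \<in> space M \<longrightarrow> 0 < n \<longrightarrow> e < A n (g k) x \<longrightarrow> x \<in> E k) \<and>
        e * prob (E k) \<le> (\<integral>x. g k x \<partial>M)"
      using choice[of "\<lambda>k E. E \<in> sets M \<and>
        (\<forall>x n. x \<in> space M \<longrightarrow> 0 < n \<longrightarrow> e < A n (g k) x \<longrightarrow> x \<in> E) \<and>
        e * prob E \<le> (\<integral>x. g k x \<partial>M)"] by blast
    then have E: "\<And>k. E k \<in> sets M"
      "\<And>k x n. x \<in> space M \<Longrightarrow> 0 < n \<Longrightarrow> e < A n (g k) x \<Longrightarrow> x \<in> E k"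
      "\<And>k. e * prob (E k) \<le> (\<integral>x. g k x \<partial>M)"
      by blast+
    have [measurable]: "(\<Inter>k. E k) \<in> sets M" using E(1) by auto
    have "e * prob (\<Inter>k. E k) \<le> (\<integral>x. g k x \<partial>M)" for k
    proof -
      have "prob (\<Inter>k. E k) \<le> prob (E k)" using E(1) by (intro finite_measure_mono) auto
      then have "e * prob (\<Inter>k. E k) \<le> e * prob (E k)" using e by simp
      with E(3)[of k] show ?thesis by linarith
    qed
    then have "e * prob (\<Inter>k. E k) \<le> 0" using g_lim by (intro LIMSEQ_le_const) auto
    then have "prob (\<Inter>k. E k) = 0" using e by (simp add: mult_le_0_iff measure_le_0_iff)
    then have "AE x in M. x \<notin> (\<Inter>k. E k)"
      by (intro AE_not_in) (simp add: null_sets_def emeasure_eq_measure)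
    then show ?thesis
      using AE_space
    proof eventually_elim
      case (elim x)
      then obtain k where "x \<notin> E k" by blast
      then have "\<forall>n>0. A n (g k) x \<le> e" using E(2)[OF elim(2), of _ k] by (meson not_less)
      then show ?case ..
    qed
  qed
  \<comment> \<open>Countably many tolerances, so that the exceptional sets together remain
    null.\<close>
  then have "AE x in M. \<forall>j. \<exists>k. \<forall>n>0. A n (g k) x \<le> inverse (real (Suc j))"
    by (simp add: AE_all_countable)
  moreover have "AE x in M. \<forall>k. convergent (\<lambda>n. A n (f' k) x)"
    unfolding AE_all_countable
  proof
    fix k
    show "AE x in M. convergent (\<lambda>n. A n (f' k) x)"
      by (rule AE_convergent_A_bounded[where C = "real k"]) (use f(2) in \<open>auto simp: f'_def\<close>)
  qed
  ultimately show ?thesis using AE_space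
  proof eventually_elim
    case (elim x)
    have "Cauchy (\<lambda>n. A n f x)"
    proof (rule metric_CauchyI)
      fix e :: real assume "0 < e"
      then obtain j where j: "inverse (real (Suc j)) < e / 2" using reals_Archimedean[of "e / 2"] by auto
      from elim(1) obtain k where k: "\<And>n. n > 0 \<Longrightarrow> A n (g k) x \<le> inverse (real (Suc j))" by blast
      from elim(2) have "Cauchy (\<lambda>n. A n (f' k) x)" by (simp add: Cauchy_convergent_iff)
      then obtain N where N: "\<And>i n. i \<ge> N \<Longrightarrow> n \<ge> N \<Longrightarrow> dist (A i (f' k) x) (A n (f' k) x) < e / 2"
        using metric_CauchyD[of _ "e / 2"] \<open>0 < e\<close> by (metis half_gt_zero)
      have split: "A n f x = A n (f' k) x + A n (g k) x" for n
        using ergodic_average_add[of S n "f' k" "g k" x] by (simp add: g_def)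
      have nonneg: "0 \<le> A n (g k) x" for n using g_nonneg elim by (intro A_nonneg)
      \<comment> \<open>Both averages of \<open>g k\<close> lie between 0 and
        \<open>inverse (real (Suc j))\<close>, so they differ by less than \<open>e / 2\<close>. The
        upper bound requires a positive index, hence \<open>max N 1\<close>.\<close>
      have "dist (A i f x) (A n f x) < e" if "i \<ge> max N 1" "n \<ge> max N 1" for i n
        using that N[of i n] k[of i] k[of n] nonneg[of i] nonneg[of n] j
        unfolding split dist_real_def abs_less_iff by auto
      then show "\<exists>N. \<forall>i\<ge>N. \<forall>n\<ge>N. dist (A i f x) (A n f x) < e" by blast
    qed
    then show ?case by (simp add: Cauchy_convergent_iff)
  qed
qed

section \<open>Identification of the limit, and functions of arbitrary sign\<close>

text \<open>Once the averages converge, their limit is their lower limit, so the function from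
  \<open>lower_average\<close> serves as the limit.\<close>

lemma pointwise_ergodic_nonneg:
  assumes f: "integrable M f" "\<And>x. 0 \<le> f x"
  obtains l where "integrable M l" "AE x in M. (\<lambda>n. A n f x) \<longlonglongrightarrow> l x"
    "AE x in M. U l x = l x" "(\<integral>x. l x \<partial>M) = (\<integral>x. f x \<partial>M)"
proof -
  obtain l where l: "integrable M l" "\<And>x. 0 \<le> l x"
    "AE x in M. liminf (\<lambda>n. ennreal (A n f x)) = ennreal (l x)"
    "AE x in M. U l x = l x" "(\<integral>x. l x \<partial>M) = (\<integral>x. f x \<partial>M)"
    by (rule lower_average[OF f]) (rule that)
  have "AE x in M. (\<lambda>n. A n f x) \<longlonglongrightarrow> l x"
    using AE_convergent_A_nonneg[OF f] l(3) AE_space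
  proof eventually_elim
    case (elim x)
    then obtain c where c: "(\<lambda>n. A n f x) \<longlonglongrightarrow> c" by (auto simp: convergent_def)
    then have "liminf (\<lambda>n. ennreal (A n f x)) = ennreal c"
      by (intro lim_imp_Liminf tendsto_ennrealI) auto
    \<comment> \<open>\<open>ennreal\<close> is injective only on nonnegative reals, so
      \<open>c = l x\<close> requires the sign of \<open>c\<close>.\<close>
    moreover have "0 \<le> c"
      using c elim f(2) by (intro LIMSEQ_le_const[OF c]) (auto intro!: A_nonneg)
    ultimately show ?case using c elim(2) l(2)[of x] by simp
  qed
  with l that show thesis by blast
qed

lemma pointwise_ergodic:
  assumes f: "integrable M f"
  shows "\<exists>l. integrable M l \<and> (AE x in M. (\<lambda>n. A n f x) \<longlonglongrightarrow> l x) \<and>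
    (AE x in M. U l x = l x) \<and> (\<integral>x. l x \<partial>M) = (\<integral>x. f x \<partial>M)"
proof -
  let ?p = "\<lambda>x. max 0 (f x)" and ?q = "\<lambda>x. max 0 (- f x)"
  have pq: "integrable M ?p" "integrable M ?q" using f by auto
  have f_eq: "f = (\<lambda>x. ?p x - ?q x)" by (auto simp: fun_eq_iff)
  obtain p where p: "integrable M p" "AE x in M. (\<lambda>n. A n ?p x) \<longlonglongrightarrow> p x"
    "AE x in M. U p x = p x" "(\<integral>x. p x \<partial>M) = (\<integral>x. ?p x \<partial>M)"
    by (rule pointwise_ergodic_nonneg[OF pq(1)]) (simp, rule that)
  obtain q where q: "integrable M q" "AE x in M. (\<lambda>n. A n ?q x) \<longlonglongrightarrow> q x"
    "AE x in M. U q x = q x" "(\<integral>x. q x \<partial>M) = (\<integral>x. ?q x \<partial>M)"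
    by (rule pointwise_ergodic_nonneg[OF pq(2)]) (simp, rule that)
  show ?thesis
  proof (intro exI[of _ "\<lambda>x. p x - q x"] conjI)
    show "integrable M (\<lambda>x. p x - q x)" using p q by simp
    show "AE x in M. (\<lambda>n. A n f x) \<longlonglongrightarrow> p x - q x"
      using p(2) q(2)
    proof eventually_elim
      case (elim x)
      then have "(\<lambda>n. A n ?p x - A n ?q x) \<longlonglongrightarrow> p x - q x" by (rule tendsto_diff)
      then show ?case by (subst f_eq) (simp only: ergodic_average_diff)
    qed
    show "AE x in M. U (\<lambda>x. p x - q x) x = p x - q x"
      using p(3) q(3) by eventually_elim (simp add: multi_koopman_diff)
    have "(\<integral>x. f x \<partial>M) = (\<integral>x. ?p x - ?q x \<partial>M)" by (subst f_eq) simp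
    with p q pq show "(\<integral>x. p x - q x \<partial>M) = (\<integral>x. f x \<partial>M)" by simp
  qed
qed

end

theorem theorem1:
  fixes M :: "'a measure" and S :: "'a \<Rightarrow> 'a set" and m :: nat and f :: "'a \<Rightarrow> real"
  assumes "prob_space M"
    and "m \<ge> 1"
    and "m_transformation m M S"
    and "multi_measure_preserving M S"
    and "integrable M f"
  shows "\<exists>fstar :: 'a \<Rightarrow> real. integrable M fstar \<and>
           (AE x in M. (\<lambda>n. ergodic_average S n f x) \<longlonglongrightarrow> fstar x) \<and>
           (AE x in M. multi_koopman S fstar x = fstar x) \<and>
           (\<integral>x. fstar x \<partial>M) = (\<integral>x. f x \<partial>M)"
proof -
  interpret preserving_multi_map M S m
    using assms by (simp add: preserving_multi_map_def preserving_multi_map_axioms_def)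
  show ?thesis using assms(5) by (rule pointwise_ergodic)
qed

end
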